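(* Let $x \in \{com, prf, grd\}$. For may-must argumentations $F = (A,R,f_Q) \in \mathcal{F}$, neither $\Lambda^{exact}_F \subseteq \Lambda^{adf.x}_F$ nor $\Lambda^{adf.x}_F \subseteq \Lambda^{exact}_F$ generally holds; that is, for each such $x$ there is some $F \in \mathcal{F}$ with $\Lambda^{exact}_F \not\subseteq \Lambda^{adf.x}_F$, and there is some $F \in \mathcal{F}$ with $\Lambda^{adf.x}_F \not\subseteq \Lambda^{exact}_F$.
   Context: $\mathbb{N}$ includes $0$. $\mathcal{A}$ is a class of abstract entities called arguments. $\mathcal{L} = \{\mathsf{in}, \mathsf{out}, \mathsf{undec}\}$. $\Lambda$ is the class of all partial functions $\mathcal{A} \to \mathcal{L}$, and for $A \subseteq \mathcal{A}$, $\Lambda^A$ is the class of those $\lambda\in\Lambda$ defined exactly on $A$. For $\lambda_1,\lambda_2\in\Lambda$, $\lambda_1 \preceq \lambda_2$ iff there is a finite $A\subseteq\mathcal{A}$ with $\lambda_1,\lambda_2\in\Lambda^A$ and, for every $a \in A$, $\lambda_1(a)=\mathsf{in}$ implies $\lambda_2(a)=\mathsf{in}$ and $\lambda_1(a)=\mathsf{out}$ implies $\lambda_2(a)=\mathsf{out}$. A may-must argumentation is a tuple $F = (A, R, f_Q)$ with $A \subseteq \mathcal{A}$ finite, $R \subseteq A \times A$ (the attack relation), and $f_Q : A \to (\mathbb{N}\times\mathbb{N})\times(\mathbb{N}\times\mathbb{N})$ such that, writing $f_Q(a) = ((n_1^a, n_2^a),(m_1^a,m_2^a))$, one has $n_1^a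 \le n_2^a$ and $m_1^a \le m_2^a$ for every $a\in A$. $\mathcal{F}$ denotes the class of all may-must argumentations. For $a \in A$, $\mathsf{pred}^F(a) = \{a_x \in A \mid (a_x,a)\in R\}$; for $\lambda\in\Lambda$, $\mathsf{pred}^F_{\lambda,\mathsf{in}}(a)$ (resp. $\mathsf{pred}^F_{\lambda,\mathsf{out}}(a)$) is the set of those $a_x \in \mathsf{pred}^F(a)$ for which $\lambda$ is defined and $\lambda(a_x)=\mathsf{in}$ (resp. $\mathsf{out}$). Satisfaction (for $\lambda \in \Lambda$ and $a\in A$ for which $\lambda$ is defined), with $o = |\mathsf{pred}^F_{\lambda,\mathsf{out}}(a)|$ and $i=|\mathsf{pred}^F_{\lambda,\mathsf{in}}(a)|$: under $\lambda$ in $F$, $a$ satisfies may-a iff $n_1^a \le o$; must-a iff $n_2^a \le o$; may$_s$-a iff $n_1^a \le o < n_2^a$; not-a iff $o < n_1^a$; may-r iff $m_1^a \le i$; must-r iff $m_2^a \le i$; may$_s$-r iff $m_1^a \le i < m_2^a$; not-r iff $i < m_1^a$. Designation: $\lambda\in\Lambda$ designates $l \in \mathcal{L}$ for $a\in A$ (in $F$) iff (1) $\lambda$ is defined for every member of $\mathsf{pred}^F(a)$; (2) if $l=\mathsf{in}$, then $a$ satisfies may-a but not must-r; (3) if $l = \mathsf{out}$, then $a$ satisfies may-r but not must-a; (4) if $l=\mathsf{undec}$, then at least one of the following holds: $a$ satisfies both must-a and must-r; $a$ satisfies at least one of may$_s$-a, may$_s$-r; $a$ satisfies both not-a and not-r.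 Properness: $a$'s label is proper under $\lambda$ iff $\lambda$ is defined for $a$ and $\lambda$ designates $\lambda(a)$ for $a$. $\lambda$ is an exact labelling of $F$ iff $\lambda\in\Lambda^A$ and every $a \in A$'s label is proper under $\lambda$; $\Lambda^{exact}_F$ is the set of all exact labellings of $F$. ADF semantics for $F=(A,R,f_Q)\in\mathcal{F}$: for $\lambda\in\Lambda^A$ let $\mathsf{twoVal}_A(\lambda) = \{\lambda_x \in\Lambda^A \mid \lambda\preceq\lambda_x \text{ and } \lambda_x \text{ is maximal in } (\Lambda^A,\preceq)\}$ (so members take only values $\mathsf{in},\mathsf{out}$). Define $\Gamma^F:\Lambda^A\to\Lambda^A$ by: for $a \in A$ and $l\in\{\mathsf{in},\mathsf{out}\}$, $\Gamma^F(\lambda)(a)=l$ iff every $\lambda_x\in\mathsf{twoVal}_A(\lambda)$ designates only $l$ for $a$ in $F$; otherwise $\Gamma^F(\lambda)(a)=\mathsf{undec}$. $\Lambda^{adf.com}_F$ is the set of all fixpoints of $\Gamma^F$; $\Lambda^{adf.prf}_F$ is the set of all maximal elements of $(\Lambda^{adf.com}_F,\preceq)$; $\Lambda^{adf.grd}_F$ is the set consisting of the least fixpoint of $\Gamma^F$ with respect to $\preceq$. *)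

theory Defs
  imports Main
begin

text \<open>
  The class of arguments is the type parameter \<open>'a\<close>; partial functions from arguments to
  labels are maps.
\<close>

datatype label = In | Out | Undec

type_synonym 'a labelling = "'a \<rightharpoonup> label"

definition labellings_on :: "'a set \<Rightarrow> 'a labelling set" where
  "labellings_on A = {\<mu>. dom \<mu> = A}"

definition lab_le :: "'a labelling \<Rightarrow> 'a labelling \<Rightarrow> bool"  (infix \<open>\<preceq>\<close> 50) where
  "\<mu> \<preceq> \<nu> \<longleftrightarrow>
     (\<exists>A. finite A \<and> \<mu> \<in> labellings_on A \<and> \<nu> \<in> labellings_on A \<and>
        (\<forall>a\<in>A. (\<mu> a = Some In \<longrightarrow> \<nu> a = Some In) \<and>
               (\<mu> a = Some Out \<longrightarrow> \<nu> a = Some Out)))"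

definition maximal_in :: "'a labelling set \<Rightarrow> 'a labelling set" where
  "maximal_in X = {\<mu> \<in> X. \<forall>\<nu>\<in>X. \<mu> \<preceq> \<nu> \<longrightarrow> \<nu> = \<mu>}"

definition least_in :: "'a labelling set \<Rightarrow> 'a labelling set" where
  "least_in X = {\<mu> \<in> X. \<forall>\<nu>\<in>X. \<mu> \<preceq> \<nu>}"

text \<open>
  \<open>quant F a = ((n1, n2), (m1, m2))\<close>; the values of \<open>quant F\<close> outside \<open>args F\<close> are irrelevant.
\<close>

record 'a argumentation =
  args :: "'a set"
  attacks :: "('a \<times> 'a) set"
  quant :: "'a \<Rightarrow> (nat \<times> nat) \<times> (nat \<times> nat)"

definition n1 :: "'a argumentation \<Rightarrow> 'a \<Rightarrow> nat" where "n1 F a = fst (fst (quant F a))"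
definition n2 :: "'a argumentation \<Rightarrow> 'a \<Rightarrow> nat" where "n2 F a = snd (fst (quant F a))"
definition m1 :: "'a argumentation \<Rightarrow> 'a \<Rightarrow> nat" where "m1 F a = fst (snd (quant F a))"
definition m2 :: "'a argumentation \<Rightarrow> 'a \<Rightarrow> nat" where "m2 F a = snd (snd (quant F a))"

definition may_must_argumentations :: "'a argumentation set" where
  "may_must_argumentations =
     {F. finite (args F) \<and> attacks F \<subseteq> args F \<times> args F \<and>
         (\<forall>a\<in>args F. n1 F a \<le> n2 F a \<and> m1 F a \<le> m2 F a)}"

definition preds :: "'a argumentation \<Rightarrow> 'a \<Rightarrow> 'a set" where
  "preds F a = {b \<in> args F. (b, a) \<in> attacks F}"

definition pred_lab :: "'a argumentation \<Rightarrow> 'a labelling \<Rightarrow> label \<Rightarrow> 'a \<Rightarrow> 'a set" where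
  "pred_lab F \<mu> l a = {b \<in> preds F a. \<mu> b = Some l}"

definition n_out :: "'a argumentation \<Rightarrow> 'a labelling \<Rightarrow> 'a \<Rightarrow> nat" where
  "n_out F \<mu> a = card (pred_lab F \<mu> Out a)"

definition n_in :: "'a argumentation \<Rightarrow> 'a labelling \<Rightarrow> 'a \<Rightarrow> nat" where
  "n_in F \<mu> a = card (pred_lab F \<mu> In a)"

text \<open>
  Satisfaction is only defined for arguments of \<open>F\<close> on which the labelling is defined;
  all eight predicates are false elsewhere.
\<close>

definition sat_dom :: "'a argumentation \<Rightarrow> 'a labelling \<Rightarrow> 'a \<Rightarrow> bool" where
  "sat_dom F \<mu> a \<longleftrightarrow> a \<in> args F \<and> a \<in> dom \<mu>"

definition may_a :: "'a argumentation \<Rightarrow> 'a labelling \<Rightarrow> 'a \<Rightarrow> bool" where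
  "may_a F \<mu> a \<longleftrightarrow> sat_dom F \<mu> a \<and> n1 F a \<le> n_out F \<mu> a"

definition must_a :: "'a argumentation \<Rightarrow> 'a labelling \<Rightarrow> 'a \<Rightarrow> bool" where
  "must_a F \<mu> a \<longleftrightarrow> sat_dom F \<mu> a \<and> n2 F a \<le> n_out F \<mu> a"

definition mays_a :: "'a argumentation \<Rightarrow> 'a labelling \<Rightarrow> 'a \<Rightarrow> bool" where
  "mays_a F \<mu> a \<longleftrightarrow> sat_dom F \<mu> a \<and> n1 F a \<le> n_out F \<mu> a \<and> n_out F \<mu> a < n2 F a"

definition not_a :: "'a argumentation \<Rightarrow> 'a labelling \<Rightarrow> 'a \<Rightarrow> bool" where
  "not_a F \<mu> a \<longleftrightarrow> sat_dom F \<mu> a \<and> n_out F \<mu> a < n1 F a"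

definition may_r :: "'a argumentation \<Rightarrow> 'a labelling \<Rightarrow> 'a \<Rightarrow> bool" where
  "may_r F \<mu> a \<longleftrightarrow> sat_dom F \<mu> a \<and> m1 F a \<le> n_in F \<mu> a"

definition must_r :: "'a argumentation \<Rightarrow> 'a labelling \<Rightarrow> 'a \<Rightarrow> bool" where
  "must_r F \<mu> a \<longleftrightarrow> sat_dom F \<mu> a \<and> m2 F a \<le> n_in F \<mu> a"

definition mays_r :: "'a argumentation \<Rightarrow> 'a labelling \<Rightarrow> 'a \<Rightarrow> bool" where
  "mays_r F \<mu> a \<longleftrightarrow> sat_dom F \<mu> a \<and> m1 F a \<le> n_in F \<mu> a \<and> n_in F \<mu> a < m2 F a"

definition not_r :: "'a argumentation \<Rightarrow> 'a labelling \<Rightarrow> 'a \<Rightarrow> bool" where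
  "not_r F \<mu> a \<longleftrightarrow> sat_dom F \<mu> a \<and> n_in F \<mu> a < m1 F a"

text \<open>A labelling may designate several labels for the same argument.\<close>

definition designates :: "'a argumentation \<Rightarrow> 'a labelling \<Rightarrow> label \<Rightarrow> 'a \<Rightarrow> bool" where
  "designates F \<mu> l a \<longleftrightarrow>
     a \<in> args F \<and> preds F a \<subseteq> dom \<mu> \<and>
     (l = In \<longrightarrow> may_a F \<mu> a \<and> \<not> must_r F \<mu> a) \<and>
     (l = Out \<longrightarrow> may_r F \<mu> a \<and> \<not> must_a F \<mu> a) \<and>
     (l = Undec \<longrightarrow>
        (must_a F \<mu> a \<and> must_r F \<mu> a) \<or>
        (mays_a F \<mu> a \<or> mays_r F \<mu> a) \<or>
        (not_a F \<mu> a \<and> not_r F \<mu> a))"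

definition designates_only :: "'a argumentation \<Rightarrow> 'a labelling \<Rightarrow> label \<Rightarrow> 'a \<Rightarrow> bool" where
  "designates_only F \<mu> l a \<longleftrightarrow> (\<forall>l'. designates F \<mu> l' a \<longleftrightarrow> l' = l)"

definition proper :: "'a argumentation \<Rightarrow> 'a labelling \<Rightarrow> 'a \<Rightarrow> bool" where
  "proper F \<mu> a \<longleftrightarrow> (\<exists>l. \<mu> a = Some l \<and> designates F \<mu> l a)"

definition exact_labellings :: "'a argumentation \<Rightarrow> 'a labelling set" where
  "exact_labellings F = {\<mu> \<in> labellings_on (args F). \<forall>a\<in>args F. proper F \<mu> a}"

definition two_val :: "'a set \<Rightarrow> 'a labelling \<Rightarrow> 'a labelling set" where
  "two_val A \<mu> = {\<nu> \<in> labellings_on A. \<mu> \<preceq> \<nu> \<and> \<nu> \<in> maximal_in (labellings_on A)}"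

text \<open>
  For finite \<open>A\<close> and \<open>\<mu> \<in> labellings_on A\<close> the set \<open>two_val A \<mu>\<close> is nonempty, so the
  conditions for \<open>In\<close> and \<open>Out\<close> exclude each other and the order of the tests is immaterial.
\<close>

definition Gamma_op :: "'a argumentation \<Rightarrow> 'a labelling \<Rightarrow> 'a labelling" where
  "Gamma_op F \<mu> = (\<lambda>a.
     if a \<in> args F then
       Some (if \<forall>\<nu>\<in>two_val (args F) \<mu>. designates_only F \<nu> In a then In
             else if \<forall>\<nu>\<in>two_val (args F) \<mu>. designates_only F \<nu> Out a then Out
             else Undec)
     else None)"

datatype semantics = Com | Prf | Grd

definition adf_com :: "'a argumentation \<Rightarrow> 'a labelling set" where
  "adf_com F = {\<mu> \<in> labellings_on (args F). Gamma_op F \<mu> = \<mu>}"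

fun adf :: "semantics \<Rightarrow> 'a argumentation \<Rightarrow> 'a labelling set" where
  "adf Com F = adf_com F"
| "adf Prf F = maximal_in (adf_com F)"
| "adf Grd F = least_in (adf_com F)"

end

theory Submission
  imports Defs
begin

text \<open>
  One argument suffices, which matters because the type of arguments may have a single element.
  Without attacks, thresholds \<open>((0, 1), (1, 1))\<close> designate both \<open>In\<close> and \<open>Undec\<close>; both labels
  are exact, but the ambiguity makes \<open>Undec\<close> the only value of the ADF operator.
  With a self-attack, thresholds \<open>((0, 0), (1, 1))\<close> make \<open>In\<close> designate \<open>Undec\<close>, while \<open>Out\<close> and
  \<open>Undec\<close> designate \<open>In\<close>. Hence no labelling is exact, whereas \<open>Undec\<close> is the only fixpoint of
  the ADF operator, which inspects only the two-valued completions \<open>In\<close> and \<open>Out\<close>.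
\<close>

lemma labellings_on_singleton: "labellings_on {a} = range (\<lambda>l. [a \<mapsto> l])"
proof -
  have "\<mu> \<in> range (\<lambda>l. [a \<mapsto> l])" if "dom \<mu> = {a}" for \<mu> :: "'a labelling"
    using that by (auto simp: dom_eq_singleton_conv)
  then show ?thesis
    by (auto simp: labellings_on_def split: if_splits)
qed

text \<open>On one argument the order is flat: \<open>Undec\<close> at the bottom, \<open>In\<close>
  and \<open>Out\<close> incomparable above it.\<close>

lemma lab_le_singleton: "[a \<mapsto> k] \<preceq> [a \<mapsto> l] \<longleftrightarrow> k = Undec \<or> k = l"
  by (cases k; cases l) (auto simp: lab_le_def labellings_on_def)

lemma singleton_labelling_eq_iff: "[a \<mapsto> k] = [a \<mapsto> l] \<longleftrightarrow> k = l"
  by (metis fun_upd_same option.inject)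

lemma maximal_in_labellings_on_singleton:
  "[a \<mapsto> l] \<in> maximal_in (labellings_on {a}) \<longleftrightarrow> l \<noteq> Undec"
proof -
  have "[a \<mapsto> l] \<in> maximal_in (labellings_on {a}) \<longleftrightarrow> (\<forall>k. l = Undec \<or> l = k \<longrightarrow> k = l)"
    by (simp add: maximal_in_def labellings_on_singleton lab_le_singleton
        singleton_labelling_eq_iff del: fun_upd_apply)
  also have "\<dots> \<longleftrightarrow> l \<noteq> Undec"
    by (metis label.distinct(3))
  finally show ?thesis .
qed

lemma two_val_singleton:
  "two_val {a} [a \<mapsto> k] = (\<lambda>l. [a \<mapsto> l]) ` {l. l \<noteq> Undec \<and> (k = Undec \<or> k = l)}"
proof -
  have "two_val {a} [a \<mapsto> k] = {\<nu> \<in> range (\<lambda>l. [a \<mapsto> l]).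
      [a \<mapsto> k] \<preceq> \<nu> \<and> \<nu> \<in> maximal_in (labellings_on {a})}"
    by (simp add: two_val_def labellings_on_singleton)
  also have "\<dots> = (\<lambda>l. [a \<mapsto> l])
      ` {l. [a \<mapsto> k] \<preceq> [a \<mapsto> l] \<and> [a \<mapsto> l] \<in> maximal_in (labellings_on {a})}"
    by blast
  also have "\<dots> = (\<lambda>l. [a \<mapsto> l]) ` {l. l \<noteq> Undec \<and> (k = Undec \<or> k = l)}"
    by (simp only: lab_le_singleton maximal_in_labellings_on_singleton conj_commute)
  finally show ?thesis .
qed

text \<open>A unique fixpoint is at once maximal and least, so one counterexample serves all three
  semantics. Reflexivity is assumed because \<open>\<preceq>\<close> only relates labellings with
  finite domain.\<close>

lemma adf_eq_singleton:
  assumes "adf_com F = {\<mu>}" and "\<mu> \<preceq> \<mu>"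
  shows "adf x F = {\<mu>}"
  using assms by (cases x) (auto simp: maximal_in_def least_in_def)

text \<open>Only three labellings exist on \<open>{a}\<close>, so the fixpoints are found by
  evaluating \<open>Gamma_op\<close> at \<open>a\<close> for each of them.\<close>

lemma adf_eq_Undec:
  assumes "args F = {a}"
    and "Gamma_op F [a \<mapsto> Undec] a = Some Undec"
    and "Gamma_op F [a \<mapsto> In] a \<noteq> Some In"
    and "Gamma_op F [a \<mapsto> Out] a \<noteq> Some Out"
  shows "adf x F = {[a \<mapsto> Undec]}"
proof (rule adf_eq_singleton)
  have "Gamma_op F [a \<mapsto> l] = [a \<mapsto> l] \<longleftrightarrow> Gamma_op F [a \<mapsto> l] a = Some l" for l
    using assms(1) by (auto simp: Gamma_op_def fun_eq_iff)
  moreover have "Gamma_op F [a \<mapsto> l] a = Some l \<longleftrightarrow> l = Undec" for l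
    using assms(2-) by (cases l) auto
  ultimately have fixpoint: "Gamma_op F [a \<mapsto> l] = [a \<mapsto> l] \<longleftrightarrow> l = Undec" for l
    by (rule trans)
  have "adf_com F = (\<lambda>l. [a \<mapsto> l]) ` {l. Gamma_op F [a \<mapsto> l] = [a \<mapsto> l]}"
    unfolding adf_com_def assms(1) labellings_on_singleton by blast
  also have "\<dots> = {[a \<mapsto> Undec]}"
    unfolding fixpoint by simp
  finally show "adf_com F = {[a \<mapsto> Undec]}" .
qed (simp add: lab_le_singleton)

lemmas designation_defs = designates_def may_a_def must_a_def mays_a_def not_a_def
  may_r_def must_r_def mays_r_def not_r_def sat_dom_def n1_def n2_def m1_def m2_def

definition ambiguous :: "'a \<Rightarrow> 'a argumentation" where
  "ambiguous a = \<lparr>args = {a}, attacks = {}, quant = (\<lambda>_. ((0, 1), (1, 1)))\<rparr>"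

lemma ambiguous_may_must: "ambiguous a \<in> may_must_argumentations"
  by (simp add: ambiguous_def may_must_argumentations_def n1_def n2_def m1_def m2_def)

text \<open>Both counts are 0 whatever \<open>k\<close> is: \<open>may_a\<close> without
  \<open>must_r\<close> gives \<open>In\<close>, \<open>mays_a\<close> gives \<open>Undec\<close>,
  and failure of \<open>may_r\<close> excludes \<open>Out\<close>.\<close>

lemma designates_ambiguous: "designates (ambiguous a) [a \<mapsto> k] l a \<longleftrightarrow> l \<noteq> Out"
  by (cases l) (auto simp: ambiguous_def designation_defs n_in_def n_out_def pred_lab_def preds_def)

lemma adf_ambiguous: "adf x (ambiguous a) = {[a \<mapsto> Undec]}"
proof -
  have args: "args (ambiguous a) = {a}"
    by (simp add: ambiguous_def)
  have not_only: "\<not> designates_only (ambiguous a) [a \<mapsto> k] l a" for k l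
  proof -
    have "designates (ambiguous a) [a \<mapsto> k] In a" "designates (ambiguous a) [a \<mapsto> k] Undec a"
      by (simp_all only: designates_ambiguous label.distinct not_False_eq_True)
    then show ?thesis
      unfolding designates_only_def by (metis label.distinct(4))
  qed
  have "Gamma_op (ambiguous a) [a \<mapsto> k] a = Some Undec" for k
  proof -
    \<comment> \<open>Without a completion, the test for \<open>In\<close> in
      \<open>Gamma_op\<close> would hold vacuously.\<close>
    have "\<exists>l. [a \<mapsto> l] \<in> two_val {a} [a \<mapsto> k]"
      unfolding two_val_singleton by (cases k) blast+
    with not_only
    have "\<not> (\<forall>\<nu>\<in>two_val {a} [a \<mapsto> k]. designates_only (ambiguous a) \<nu> l a)" for l
      by blast
    then show ?thesis
      by (simp only: Gamma_op_def args singletonI if_True if_False)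
  qed
  then show ?thesis
    by (intro adf_eq_Undec) (auto simp: args)
qed

lemma exact_ambiguous: "[a \<mapsto> In] \<in> exact_labellings (ambiguous a)"
proof -
  have "args (ambiguous a) = {a}"
    by (simp add: ambiguous_def)
  then show ?thesis
    by (simp add: exact_labellings_def labellings_on_def proper_def designates_ambiguous)
qed

definition self_defeating :: "'a \<Rightarrow> 'a argumentation" where
  "self_defeating a = \<lparr>args = {a}, attacks = {(a, a)}, quant = (\<lambda>_. ((0, 0), (1, 1)))\<rparr>"

lemma self_defeating_may_must: "self_defeating a \<in> may_must_argumentations"
  by (simp add: self_defeating_def may_must_argumentations_def n1_def n2_def m1_def m2_def)

text \<open>\<open>must_a\<close> always holds, which excludes \<open>Out\<close>, and equal
  thresholds exclude \<open>mays_a\<close> and \<open>mays_r\<close>. What remains depends on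
  \<open>must_r\<close>, which holds exactly when \<open>a\<close> is labelled
  \<open>In\<close>.\<close>

lemma designates_self_defeating:
  "designates (self_defeating a) [a \<mapsto> k] l a \<longleftrightarrow> l = (if k = In then Undec else In)"
proof -
  have "preds (self_defeating a) a = {a}"
    by (auto simp: self_defeating_def preds_def)
  then have "pred_lab (self_defeating a) [a \<mapsto> k] l' a = (if k = l' then {a} else {})" for l'
    by (auto simp: pred_lab_def)
  then have "n_in (self_defeating a) [a \<mapsto> k] a = (if k = In then 1 else 0)"
    and "n_out (self_defeating a) [a \<mapsto> k] a = (if k = Out then 1 else 0)"
    by (auto simp: n_in_def n_out_def)
  then show ?thesis
    using \<open>preds (self_defeating a) a = {a}\<close>
    by (cases k; cases l) (auto simp: designation_defs self_defeating_def)
qed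

lemma adf_self_defeating: "adf x (self_defeating a) = {[a \<mapsto> Undec]}"
proof -
  have args: "args (self_defeating a) = {a}"
    by (simp add: self_defeating_def)
  have only: "designates_only (self_defeating a) [a \<mapsto> k] l a
      \<longleftrightarrow> l = (if k = In then Undec else In)" for k l
    unfolding designates_only_def designates_self_defeating by metis
  show ?thesis
    \<comment> \<open>The completions of \<open>Undec\<close> disagree: \<open>Out\<close>
      designates \<open>In\<close>, while \<open>In\<close> designates \<open>Undec\<close>.\<close>
    by (rule adf_eq_Undec) (auto simp: args Gamma_op_def two_val_singleton only)
qed

lemma exact_self_defeating: "exact_labellings (self_defeating a) = {}"
proof -
  have "args (self_defeating a) = {a}"
    by (simp add: self_defeating_def)
  then show ?thesis
    by (auto simp: exact_labellings_def labellings_on_singleton proper_def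
        designates_self_defeating split: if_splits)
qed

theorem theorem5:
  fixes x :: semantics
  shows "(\<exists>F :: 'a argumentation.
            F \<in> may_must_argumentations \<and> \<not> exact_labellings F \<subseteq> adf x F) \<and>
         (\<exists>F :: 'a argumentation.
            F \<in> may_must_argumentations \<and> \<not> adf x F \<subseteq> exact_labellings F)"
proof -
  \<comment> \<open>Types are inhabited, so an arbitrary element can carry both examples.\<close>
  fix a :: 'a
  have "[a \<mapsto> In] \<notin> adf x (ambiguous a)"
    unfolding adf_ambiguous singleton_iff singleton_labelling_eq_iff by (rule label.distinct(3))
  then have "\<not> exact_labellings (ambiguous a) \<subseteq> adf x (ambiguous a)"
    using exact_ambiguous[of a] by (metis subsetD)
  moreover have "\<not> adf x (self_defeating a) \<subseteq> exact_labellings (self_defeating a)"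
    unfolding adf_self_defeating exact_self_defeating by simp
  ultimately show ?thesis
    using ambiguous_may_must[of a] self_defeating_may_must[of a] by metis
qed

end
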